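(* Let $\beta\in\mathbb{C}$, $n\ge 4$, and let $\varphi$ be a $\frac12$-derivation of the Lie algebra $\mathfrak{s}^{1}_{n,1}(\beta)$. (1) If $n=4$, then there are complex numbers $\alpha_1,\alpha_2,\alpha_3,\alpha_4,\beta_3,\beta_4,\delta_4$ with $(\beta-2)\alpha_2=(\beta-2)\beta_3=(2-\beta)\beta_4=0$ such that $$\varphi(e_1)=\alpha_1e_1+\alpha_2e_2+\alpha_3e_3+\alpha_4e_4,\quad \varphi(e_2)=\alpha_1e_2+\beta_3e_3+\beta_4e_4,\quad \varphi(e_3)=\alpha_1e_3+\tfrac12\beta_3e_4,$$ $$\varphi(e_4)=\alpha_1e_4,\quad \varphi(x)=\beta_3e_1+(\beta-1)\alpha_3e_2+\beta\alpha_4e_3+\delta_4e_4+\alpha_1x.$$ (2) If $n\ge5$, then there are complex numbers $\alpha_1,\dots,\alpha_n,\beta_n,\delta_n$ with $(\beta-2)\alpha_2=(n-2-\beta)\beta_n=0$ such that $$\varphi(e_1)=\sum_{i=1}^n\alpha_ie_i,\quad \varphi(e_2)=\alpha_1e_2+\beta_ne_n,\quad \varphi(e_i)=\alpha_1e_i\ (3\le i\le n),$$ $$\varphi(x)=\sum_{i=2}^{n-1}(i-3+\beta)\alpha_{i+1}e_i+\delta_ne_n+\alpha_1x.$$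
   Context: All algebras are over $\mathbb{C}$. A $\frac12$-derivation of a Lie algebra $(\mathfrak{L},[-,-])$ is a linear map $\varphi:\mathfrak{L}\to\mathfrak{L}$ with $\varphi([u,v])=\frac12([\varphi(u),v]+[u,\varphi(v)])$ for all $u,v\in\mathfrak{L}$. $\mathfrak{s}^{1}_{n,1}(\beta)$ is the $(n+1)$-dimensional Lie algebra with basis $e_1,\dots,e_n,x$ and brackets $[e_i,e_1]=e_{i+1}$ for $2\le i\le n-1$; $[e_1,x]=e_1$; $[e_i,x]=(i-2+\beta)e_i$ for $2\le i\le n$; brackets of basis elements not determined by these and antisymmetry are zero. *)

theory Defs
  imports "HOL-Analysis.Analysis"
begin

locale lie_algebra = vector_space scl
  for scl :: "complex \<Rightarrow> 'a::ab_group_add \<Rightarrow> 'a" (infixr \<open>\<odot>\<close> 75) +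
  fixes brk :: "'a \<Rightarrow> 'a \<Rightarrow> 'a"
  assumes linear_left: "\<And>v. Vector_Spaces.linear scl scl (\<lambda>u. brk u v)"
    and linear_right: "\<And>u. Vector_Spaces.linear scl scl (brk u)"
    and alternating: "\<And>u. brk u u = 0"
    and jacobi: "\<And>u v w. brk u (brk v w) + brk v (brk w u) + brk w (brk u v) = 0"

definition half_derivation ::
  "(complex \<Rightarrow> 'a::ab_group_add \<Rightarrow> 'a) \<Rightarrow> ('a \<Rightarrow> 'a \<Rightarrow> 'a) \<Rightarrow> ('a \<Rightarrow> 'a) \<Rightarrow> bool"
  where "half_derivation scl brk \<phi> \<longleftrightarrow>
    Vector_Spaces.linear scl scl \<phi> \<and>
    (\<forall>u v. \<phi> (brk u v) = scl (1/2) (brk (\<phi> u) v + brk u (\<phi> v)))"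

text \<open>The algebra is the whole type \<open>'a\<close>, given up to isomorphism by a basis and its structure
  constants. The vanishing of the brackets of \<open>e 1\<close> and of \<open>x\<close> with themselves, and the brackets
  in the opposite order, come from \<open>alternating\<close>.\<close>

locale s1_algebra = lie_algebra scl brk
  for scl :: "complex \<Rightarrow> 'a::ab_group_add \<Rightarrow> 'a" (infixr \<open>\<odot>\<close> 75)
    and brk :: "'a \<Rightarrow> 'a \<Rightarrow> 'a" +
  fixes n :: nat and \<beta> :: complex and e :: "nat \<Rightarrow> 'a" and x :: 'a
  assumes inj_e: "inj_on e {1..n}"
    and x_notin: "x \<notin> e ` {1..n}"
    and independent_basis: "independent (insert x (e ` {1..n}))"
    and span_basis: "span (insert x (e ` {1..n})) = UNIV"
    and brk_e_e1: "\<And>i. 2 \<le> i \<Longrightarrow> i \<le> n - 1 \<Longrightarrow> brk (e i) (e 1) = e (i + 1)"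
    and brk_e1_x: "brk (e 1) x = e 1"
    and brk_e_x: "\<And>i. 2 \<le> i \<Longrightarrow> i \<le> n \<Longrightarrow> brk (e i) x = (of_nat i - 2 + \<beta>) \<odot> e i"
    and brk_en_e1: "brk (e n) (e 1) = 0"
    and brk_e_e: "\<And>i j. 2 \<le> i \<Longrightarrow> i \<le> n \<Longrightarrow> 2 \<le> j \<Longrightarrow> j \<le> n \<Longrightarrow> brk (e i) (e j) = 0"

text \<open>Such an algebra exists for all \<open>n \<ge> 2\<close> and \<open>\<beta>\<close>: coordinate \<open>h 0\<close> below is that of \<open>x\<close>,
  coordinate \<open>h i\<close> that of \<open>e i\<close>.\<close>

lemma s1_algebra_exists:
  fixes \<beta> :: complex
  assumes n: "n \<ge> 2" and card: "CARD('k::finite) = n + 1"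
  shows "\<exists>brk e (x :: complex ^ 'k). s1_algebra (*s) brk n \<beta> e x"
proof -
  obtain h :: "nat \<Rightarrow> 'k" where h: "bij_betw h {0..<CARD('k)} UNIV"
    using ex_bij_betw_nat_finite[of "UNIV :: 'k set"] by auto
  define g where "g = inv_into {0..n} h"
  have h': "bij_betw h {0..n} UNIV"
    using h card by (simp add: atLeastLessThanSuc_atLeastAtMost)
  have gh: "g (h i) = i" if "i \<le> n" for i
    using h' that unfolding g_def by (intro bij_betw_inv_into_left) auto
  have hg: "h (g k) = k" for k
    using h' unfolding g_def by (intro bij_betw_inv_into_right) auto
  have gn: "g k \<le> n" for k
    using h' inv_into_into[of k h "{0..n}"] unfolding g_def bij_betw_def by auto
  define c :: "nat \<Rightarrow> complex ^ 'k \<Rightarrow> complex ^ 'k \<Rightarrow> complex" where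
    "c m u v = (if m = 0 then 0
      else if m = 1 then u $ h 1 * v $ h 0 - u $ h 0 * v $ h 1
      else (of_nat m - 2 + \<beta>) * (u $ h m * v $ h 0 - u $ h 0 * v $ h m)
        + (if m = 2 then 0 else u $ h (m - 1) * v $ h 1 - u $ h 1 * v $ h (m - 1)))" for m u v
  define brk where "brk u v = (\<chi> k. c (g k) u v)" for u v :: "complex ^ 'k"
  define e :: "nat \<Rightarrow> complex ^ 'k" where "e i = axis (h i) 1" for i
  have hh: "h i = h j \<longleftrightarrow> i = j" if "i \<le> n" "j \<le> n" for i j
    using gh that by metis
  have eh: "e i $ h j = (if i = j then 1 else 0)" if "i \<le> n" "j \<le> n" for i j
    using hh that by (auto simp: e_def axis_def)
  have bh: "brk u v $ h m = c m u v" if "m \<le> n" for u v m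
    using gh that by (simp add: brk_def)
  have eqI: "u = v" if "\<And>m. m \<le> n \<Longrightarrow> u $ h m = v $ h m" for u v :: "complex ^ 'k"
    unfolding vec_eq_iff using that gn hg by metis
  have basis: "insert (e 0) (e ` {1..n}) = cart_basis"
  proof -
    have "insert (e 0) (e ` {1..n}) = e ` {0..n}"
      by (metis atLeastAtMost_insertL le0 image_insert One_nat_def)
    also have "\<dots> = (\<lambda>k. axis k 1) ` h ` {0..n}" by (auto simp: e_def)
    also have "\<dots> = cart_basis"
      using h' by (auto simp: bij_betw_def cart_basis_def)
    finally show ?thesis .
  qed
  have inj: "inj_on e {0..n}"
    by (intro inj_onI) (metis eh atLeastAtMost_iff zero_neq_one)
  have "s1_algebra (*s) brk n \<beta> e (e 0)"
  proof (intro s1_algebra.intro lie_algebra.intro s1_algebra_axioms.intro lie_algebra_axioms.intro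
      vec.vector_space_axioms)
    show "Vector_Spaces.linear (*s) (*s) (\<lambda>u. brk u v)" for v
      by (rule Vector_Spaces.linear_iff[THEN iffD2], intro conjI vec.vector_space_axioms)
        (auto simp: brk_def c_def vec_eq_iff algebra_simps)
    show "Vector_Spaces.linear (*s) (*s) (brk u)" for u
      by (rule Vector_Spaces.linear_iff[THEN iffD2], intro conjI vec.vector_space_axioms)
        (auto simp: brk_def c_def vec_eq_iff algebra_simps)
    show "brk u u = 0" for u
      by (auto simp: brk_def c_def vec_eq_iff)
    show "brk u (brk v w) + brk v (brk w u) + brk w (brk u v) = 0" for u v w
    proof (rule eqI)
      fix m assume m: "m \<le> n"
      have "m = 0 \<or> m = 1 \<or> m = 2 \<or> m = 3 \<or> m = (m - 4) + 4"
        by arith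
      then consider "m = 0" | "m = 1" | "m = 2" | "m = 3" | k where "m = k + 4"
        by blast
      then show "(brk u (brk v w) + brk v (brk w u) + brk w (brk u v)) $ h m = 0 $ h m"
        by cases (use m n in \<open>simp_all add: bh c_def algebra_simps\<close>)
    qed
    show "inj_on e {1..n}" using inj by (rule inj_on_subset) auto
    show "e 0 \<notin> e ` {1..n}" using inj unfolding inj_on_def by fastforce
    show "vec.independent (insert (e 0) (e ` {1..n}))"
      unfolding basis by (rule independent_cart_basis)
    show "vec.span (insert (e 0) (e ` {1..n})) = UNIV"
      unfolding basis by (rule span_cart_basis)
    show "brk (e i) (e 1) = e (i + 1)" if "2 \<le> i" "i \<le> n - 1" for i
      by (rule eqI) (use that n in \<open>auto simp: bh c_def eh\<close>)
    show "brk (e 1) (e 0) = e 1"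
      by (rule eqI) (use n in \<open>auto simp: bh c_def eh\<close>)
    show "brk (e i) (e 0) = (of_nat i - 2 + \<beta>) *s e i" if "2 \<le> i" "i \<le> n" for i
      by (rule eqI) (use that n in \<open>auto simp: bh c_def eh\<close>)
    show "brk (e n) (e 1) = 0"
      by (rule eqI) (use n in \<open>auto simp: bh c_def eh\<close>)
    show "brk (e i) (e j) = 0" if "2 \<le> i" "i \<le> n" "2 \<le> j" "j \<le> n" for i j
      by (rule eqI) (use that n in \<open>auto simp: bh c_def eh\<close>)
  qed
  then show ?thesis by blast
qed

end

(*
  Compare coordinates in the derivation rule for each pair of basis elements, and let a(m,i) be the
  coefficient of e m in phi (e i). The pairs (e i, e j) with small indices, together with
  [e i, e 1] = e (i + 1), remove e 1 and x from phi (e i) for i at least 2. The pair (e i, e 1)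
  gives a(m + 1, i + 1) = a(m, i) / 2 off the diagonal, so everything is determined by phi (e 2) and
  the matrix is lower triangular. The pair (e i, x) compares weights:
  (2 w(i) - w(m)) a(m, i) = 0 unless m is i or i + 1. Along a diagonal m - i = k at least 2 the
  factor equals beta + i - 2 - k, which cannot vanish at both i = 2 and i = 3; only the corner
  a(n, 2) escapes because its diagonal has length one. On the first subdiagonal the value is the
  e 1 coefficient of phi x for every i, which for n at least 5 overdetermines a(3, 2).
*)

theory Submission
  imports Defs
begin

section \<open>Coordinates with respect to the basis \<open>x\<close>, \<open>e 1\<close>, ...,
  \<open>e n\<close>\<close>

context s1_algebra
begin

text \<open>Index \<open>0\<close> stands for \<open>x\<close>, so that \<open>weight m\<close> is the eigenvalue of
  \<open>\<lambda>u. brk u x\<close> on the basis element with index \<open>m\<close>.\<close>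

definition basis_vec :: "nat \<Rightarrow> 'a"
  where "basis_vec i = (if i = 0 then x else e i)"

text \<open>Meaningful only for \<open>m \<le> n\<close>, since \<open>e\<close> is unconstrained
  beyond \<open>n\<close>; hence the index bounds in the lemmas below.\<close>

definition coord :: "nat \<Rightarrow> 'a \<Rightarrow> complex"
  where "coord m u = representation (basis_vec ` {..n}) u (basis_vec m)"

definition weight :: "nat \<Rightarrow> complex"
  where "weight m = (if m = 0 then 0 else if m = 1 then 1 else of_nat m - 2 + \<beta>)"

lemma basis_vec_0: "basis_vec 0 = x"
  by (simp add: basis_vec_def)

lemma basis_vec_e: "i \<in> {1..n} \<Longrightarrow> basis_vec i = e i"
  by (simp add: basis_vec_def)

lemma atMost_eq_insert_0: "{..n} = insert 0 {1..n}"
  by auto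

lemma basis_vec_image: "basis_vec ` {..n} = insert x (e ` {1..n})"
  unfolding atMost_eq_insert_0 image_insert basis_vec_0
  by (rule arg_cong[where f = "insert x"], rule image_cong) (rule refl, rule basis_vec_e)

lemma inj_basis_vec: "inj_on basis_vec {..n}"
proof -
  have image: "basis_vec ` {1..n} = e ` {1..n}"
    by (rule image_cong) (rule refl, rule basis_vec_e)
  have "inj_on basis_vec {1..n}"
    using inj_e inj_on_cong[of "{1..n}" basis_vec e] basis_vec_e by blast
  moreover have "basis_vec 0 \<notin> basis_vec ` ({1..n} - {0})"
    using x_notin image by (simp add: basis_vec_0)
  ultimately show ?thesis
    unfolding atMost_eq_insert_0 inj_on_insert by blast
qed

lemma independent_basis_vec: "independent (basis_vec ` {..n})"
  using independent_basis by (simp add: basis_vec_image)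

lemma span_basis_vec: "span (basis_vec ` {..n}) = UNIV"
  using span_basis by (simp add: basis_vec_image)

lemma coord_add: "coord m (u + v) = coord m u + coord m v"
  unfolding coord_def by (simp add: representation_add independent_basis_vec span_basis_vec)

lemma coord_scale: "coord m (a \<odot> u) = a * coord m u"
  unfolding coord_def by (simp add: representation_scale independent_basis_vec span_basis_vec)

lemma coord_minus: "coord m (- u) = - coord m u"
  using coord_scale[of m "-1" u] by simp

lemma coord_diff: "coord m (u - v) = coord m u - coord m v"
  using coord_add[of m u "- v"] by (simp add: coord_minus)

lemma coord_zero: "coord m 0 = 0"
  using coord_scale[of m 0 0] unfolding scale_zero_left by simp

lemma coord_sum: "coord m (\<Sum>i\<in>I. f i) = (\<Sum>i\<in>I. coord m (f i))"
  by (induction I rule: infinite_finite_induct) (simp_all add: coord_zero coord_add)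

lemma coord_basis_vec:
  assumes "i \<le> n" "m \<le> n"
  shows "coord m (basis_vec i) = (if m = i then 1 else 0)"
  using assms inj_on_eq_iff[OF inj_basis_vec, of m i] unfolding coord_def
  by (simp add: representation_basis independent_basis_vec)

lemma coord_e:
  assumes "1 \<le> i" "i \<le> n" "m \<le> n"
  shows "coord m (e i) = (if m = i then 1 else 0)"
  using coord_basis_vec[of i m] assms by (simp add: basis_vec_def)

lemma coord_x: "m \<le> n \<Longrightarrow> coord m x = (if m = 0 then 1 else 0)"
  using coord_basis_vec[of 0 m] by (simp add: basis_vec_def)

text \<open>\<open>representation\<close> vanishes off the basis, so agreement at the basis vectors
  makes both representations equal as functions, and a vector is recovered from its
  representation.\<close>

lemma coord_eqI:
  assumes "\<And>m. m \<le> n \<Longrightarrow> coord m u = coord m v"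
  shows "u = v"
proof -
  let ?r = "representation (basis_vec ` {..n})"
  have "?r u b = ?r v b" for b
  proof (cases "b \<in> basis_vec ` {..n}")
    case True
    then obtain m where "m \<le> n" "b = basis_vec m" by blast
    then show ?thesis using assms[of m] by (simp only: coord_def)
  next
    case False
    then have "?r w b = 0" for w using representation_ne_zero[of "basis_vec ` {..n}" w b] by blast
    then show ?thesis by simp
  qed
  then have eq: "?r u = ?r v" by blast
  have expand: "(\<Sum>b | ?r w b \<noteq> 0. ?r w b \<odot> b) = w" for w
    by (rule sum_nonzero_representation_eq[OF independent_basis_vec])
      (simp add: span_basis_vec)
  show ?thesis using expand[of u] unfolding eq expand by simp
qed

lemma basis_induct:
  assumes basis: "\<And>i. i \<le> n \<Longrightarrow> P (basis_vec i)"
    and zero: "P 0" and add: "\<And>u v. P u \<Longrightarrow> P v \<Longrightarrow> P (u + v)"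
    and scale: "\<And>a u. P u \<Longrightarrow> P (a \<odot> u)"
  shows "P u"
proof -
  have "u \<in> span (basis_vec ` {..n})" by (simp add: span_basis_vec)
  then show ?thesis
    by (induction rule: span_induct_alt) (use assms in auto)
qed

section \<open>Brackets with a fixed right factor, in coordinates\<close>

lemma brk_add_left: "brk (u + v) w = brk u w + brk v w"
  using linear_left by (simp add: Vector_Spaces.linear_iff)

lemma brk_add_right: "brk w (u + v) = brk w u + brk w v"
  using linear_right by (simp add: Vector_Spaces.linear_iff)

lemma brk_scale_left: "brk (a \<odot> u) w = a \<odot> brk u w"
  using linear_left by (simp add: Vector_Spaces.linear_iff)

lemma brk_zero_left: "brk 0 w = 0"
  using brk_scale_left[of 0 0 w] by simp

lemma brk_antisym: "brk u v = - brk v u"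
proof -
  have "brk u v + brk v u = brk (u + v) (u + v)"
    unfolding brk_add_left brk_add_right by (simp add: alternating)
  also have "\<dots> = 0" by (rule alternating)
  finally have "brk u v + brk v u = 0" .
  then show ?thesis by (simp add: eq_neg_iff_add_eq_0)
qed

lemma coord_brk_x:
  assumes "m \<le> n"
  shows "coord m (brk u x) = weight m * coord m u"
proof (induction u rule: basis_induct)
  case (1 i)
  have "brk (basis_vec i) x = weight i \<odot> basis_vec i"
    using 1 brk_e1_x brk_e_x[of i] by (auto simp: basis_vec_def weight_def alternating)
  then show ?case
    using 1 assms by (simp add: coord_scale coord_basis_vec)
qed (simp_all add: brk_zero_left brk_add_left brk_scale_left coord_zero coord_add coord_scale
    algebra_simps)

text \<open>Right bracketing with \<open>e 1\<close> sends \<open>x\<close> to \<open>- e 1\<close>,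
  kills \<open>e 1\<close> and \<open>e n\<close>, and raises the other indices by one; nothing
  reaches index 0 or 2.\<close>

lemma coord_brk_e1:
  assumes "m \<le> n" "1 \<le> n"
  shows "coord m (brk u (e 1)) =
    (if m = 1 then - coord 0 u else if 3 \<le> m then coord (m - 1) u else 0)"
proof (induction u rule: basis_induct)
  case (1 i)
  consider "i = 0" | "i = 1" | "2 \<le> i" "i \<le> n - 1" | "2 \<le> i" "i = n" using 1 by linarith
  then show ?case
  proof cases
    case 1
    then have "brk (basis_vec i) (e 1) = - e 1"
      using brk_antisym[of x "e 1"] brk_e1_x by (simp add: basis_vec_def)
    then show ?thesis using 1 assms by (simp add: coord_minus coord_e coord_basis_vec)
  next
    case 2
    then have "brk (basis_vec i) (e 1) = 0" by (simp add: basis_vec_def alternating)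
    then show ?thesis using 2 assms by (auto simp: coord_zero coord_basis_vec)
  next
    case 3
    then have "brk (basis_vec i) (e 1) = e (i + 1)" using brk_e_e1 by (simp add: basis_vec_def)
    then show ?thesis using 3 assms by (auto simp: coord_e coord_basis_vec)
  next
    case 4
    then have "brk (basis_vec i) (e 1) = 0" using brk_en_e1 by (simp add: basis_vec_def)
    then show ?thesis using 4 assms by (auto simp: coord_zero coord_basis_vec)
  qed
qed (auto simp: brk_zero_left brk_add_left brk_scale_left coord_zero coord_add coord_scale)

text \<open>Among basis elements only \<open>x\<close> and \<open>e 1\<close> can fail to commute
  with \<open>e j\<close>. For \<open>j = n\<close> the bound on \<open>m\<close> rules out the case
  \<open>m = j + 1\<close>, so one formula covers all \<open>j\<close>.\<close>

lemma coord_brk_e: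
  assumes "m \<le> n" "2 \<le> j" "j \<le> n"
  shows "coord m (brk u (e j)) =
    - (if m = j then weight j * coord 0 u else if m = j + 1 then coord 1 u else 0)"
proof (induction u rule: basis_induct)
  case (1 i)
  consider "i = 0" | "i = 1" | "2 \<le> i" by linarith
  then show ?case
  proof cases
    case 1
    then have "brk (basis_vec i) (e j) = - (weight j \<odot> e j)"
      using brk_antisym[of x "e j"] assms by (simp add: basis_vec_def brk_e_x weight_def)
    then show ?thesis
      using 1 assms by (simp add: coord_scale coord_minus coord_e coord_basis_vec)
  next
    case 2
    show ?thesis
    proof (cases "j = n")
      case True
      then have "brk (basis_vec i) (e j) = 0"
        using 2 brk_antisym[of "e 1" "e j"] brk_en_e1 by (simp add: basis_vec_def)
      then show ?thesis using 2 True assms by (simp add: coord_zero coord_basis_vec)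
    next
      case False
      then have "brk (basis_vec i) (e j) = - e (j + 1)"
        using 2 assms brk_antisym[of "e 1" "e j"] brk_e_e1[of j] by (simp add: basis_vec_def)
      then show ?thesis using 2 False assms by (auto simp: coord_minus coord_e coord_basis_vec)
    qed
  next
    case 3
    then have "brk (basis_vec i) (e j) = 0" using 1 assms by (simp add: basis_vec_def brk_e_e)
    then show ?thesis using 3 1 assms by (auto simp: coord_zero coord_basis_vec)
  qed
qed (auto simp: brk_zero_left brk_add_left brk_scale_left coord_zero coord_add coord_scale
    algebra_simps)

end

section \<open>The derivation rule on pairs of basis elements\<close>

locale s1_half_derivation = s1_algebra scl brk n \<beta> e x
  for scl :: "complex \<Rightarrow> 'a::ab_group_add \<Rightarrow> 'a" (infixr \<open>\<odot>\<close> 75)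
    and brk :: "'a \<Rightarrow> 'a \<Rightarrow> 'a" and n :: nat and \<beta> :: complex and e :: "nat \<Rightarrow> 'a" and x :: 'a +
  fixes \<phi> :: "'a \<Rightarrow> 'a"
  assumes half_derivation: "half_derivation scl brk \<phi>"
    and four_le: "4 \<le> n"
begin

text \<open>Row 0 holds the \<open>x\<close> components. There is no column for \<open>x\<close>
  itself: its image is written \<open>coord m (\<phi> x)\<close>.\<close>

abbreviation A :: "nat \<Rightarrow> nat \<Rightarrow> complex"
  where "A m i \<equiv> coord m (\<phi> (e i))"

lemma \<phi>_scale: "\<phi> (a \<odot> u) = a \<odot> \<phi> u"
  using half_derivation by (simp add: half_derivation_def Vector_Spaces.linear_iff)

lemma \<phi>_zero: "\<phi> 0 = 0"
  using \<phi>_scale[of 0 0] by simp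

text \<open>The second bracket is turned around so that both arguments of the derivation rule are
  brackets with a fixed right factor, whose coordinates are known.\<close>

lemma coord_\<phi>_brk:
  "2 * coord m (\<phi> (brk u v)) = coord m (brk (\<phi> u) v) - coord m (brk (\<phi> v) u)"
proof -
  have "\<phi> (brk u v) = (1/2) \<odot> (brk (\<phi> u) v + brk u (\<phi> v))"
    using half_derivation unfolding half_derivation_def by blast
  then show ?thesis
    using brk_antisym[of u "\<phi> v"] by (simp add: coord_diff coord_scale)
qed

text \<open>Expresses the coordinates 0 and 2 to \<open>n - 1\<close> of \<open>\<phi> x\<close>
  through \<open>\<phi> (e 1)\<close>.\<close>

lemma \<phi>_e1_x:
  assumes "m \<le> n"
  shows "2 * A m 1 = weight m * A m 1 -
    (if m = 1 then - coord 0 (\<phi> x) else if 3 \<le> m then coord (m - 1) (\<phi> x) else 0)"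
  using coord_\<phi>_brk[of m "e 1" x] coord_brk_x[of m "\<phi> (e 1)"] coord_brk_e1[of m "\<phi> x"]
    assms four_le brk_e1_x by simp

lemma \<phi>_e_x:
  assumes "m \<le> n" "2 \<le> i" "i \<le> n"
  shows "2 * weight i * A m i = weight m * A m i +
    (if m = i then weight i * coord 0 (\<phi> x) else if m = i + 1 then coord 1 (\<phi> x) else 0)"
proof -
  have "brk (e i) x = weight i \<odot> e i" using assms by (simp add: brk_e_x weight_def)
  then show ?thesis
    using coord_\<phi>_brk[of m "e i" x] coord_brk_x[of m "\<phi> (e i)"] coord_brk_e[of m i "\<phi> x"] assms
    by (simp add: \<phi>_scale coord_scale mult.assoc split: if_splits)
qed

lemma \<phi>_e_e1:
  assumes "m \<le> n" "2 \<le> i" "i \<le> n"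
  shows "(if i = n then 0 else 2 * A m (i + 1)) =
    (if m = 1 then - A 0 i else if 3 \<le> m then A (m - 1) i else 0) +
    (if m = i then weight i * A 0 1 else if m = i + 1 then A 1 1 else 0)"
proof -
  have "(if i = n then 0 else 2 * A m (i + 1)) = 2 * coord m (\<phi> (brk (e i) (e 1)))"
    using assms brk_e_e1[of i] brk_en_e1 by (auto simp: \<phi>_zero coord_zero)
  also have "\<dots> = coord m (brk (\<phi> (e i)) (e 1)) - coord m (brk (\<phi> (e 1)) (e i))"
    by (rule coord_\<phi>_brk)
  finally show ?thesis
    using coord_brk_e1[of m "\<phi> (e i)"] coord_brk_e[of m i "\<phi> (e 1)"] assms by simp
qed

text \<open>\<open>e i\<close> and \<open>e j\<close> commute, so the two brackets on the right of
  the rule cancel. This constrains only rows 0 and 1.\<close>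

lemma \<phi>_e_e:
  assumes "m \<le> n" "2 \<le> i" "i \<le> n" "2 \<le> j" "j \<le> n"
  shows "(if m = j then weight j * A 0 i else if m = j + 1 then A 1 i else 0) =
    (if m = i then weight i * A 0 j else if m = i + 1 then A 1 j else 0)"
  using coord_\<phi>_brk[of m "e i" "e j"] coord_brk_e[of m j "\<phi> (e i)"] coord_brk_e[of m i "\<phi> (e j)"]
    assms by (simp add: brk_e_e \<phi>_zero coord_zero split: if_splits)

section \<open>The image of \<open>e 1\<close> and its link to the image of \<open>x\<close>\<close>

lemma A_0_1: "A 0 1 = 0"
  using \<phi>_e1_x[of 0] by (simp add: weight_def)

lemma coord_0_\<phi>_x: "coord 0 (\<phi> x) = A 1 1"
  using \<phi>_e1_x[of 1] four_le by (simp add: weight_def algebra_simps)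

text \<open>No bracket with \<open>e 1\<close> reaches index 2, so only the weight term
  \<open>weight 2 = \<beta>\<close> survives.\<close>

lemma A_2_1: "(\<beta> - 2) * A 2 1 = 0"
  using \<phi>_e1_x[of 2] four_le by (simp add: weight_def algebra_simps)

text \<open>The factor is \<open>weight (i + 1) - 2\<close>, from coordinate \<open>i + 1\<close> of
  the rule.\<close>

lemma coord_\<phi>_x:
  assumes "2 \<le> i" "i \<le> n - 1"
  shows "coord i (\<phi> x) = (of_nat i - 3 + \<beta>) * A (i + 1) 1"
  using \<phi>_e1_x[of "i + 1"] assms by (auto simp: weight_def algebra_simps)

section \<open>Vanishing of the \<open>x\<close> and \<open>e 1\<close> components\<close>

lemma A_0_Suc: "2 \<le> i \<Longrightarrow> i < n \<Longrightarrow> A 0 (i + 1) = 0"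
  using \<phi>_e_e1[of 0 i] by simp

lemma A_1_Suc: "2 \<le> i \<Longrightarrow> i < n \<Longrightarrow> 2 * A 1 (i + 1) = - A 0 i"
  using \<phi>_e_e1[of 1 i] by simp

text \<open>\<open>e 2\<close> is not a bracket of some \<open>e i\<close> with \<open>e 1\<close>,
  so commuting pairs are used. With \<open>a = A 0 2\<close> they give
  \<open>weight 3 * a = - a / 2\<close> and, as \<open>weight 4 = weight 3 + 1\<close>, also
  \<open>weight 3 * a = - a\<close>.\<close>

lemma A_0_2: "A 0 2 = 0"
proof -
  have "weight 3 * A 0 2 = A 1 3"
    using \<phi>_e_e[of 3 2 3] four_le by simp
  moreover have "2 * A 1 3 = - A 0 2"
    using A_1_Suc[of 2] four_le by simp
  moreover have "A 0 4 = 0"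
    using A_0_Suc[of 3] four_le by simp
  then have "weight 4 * A 0 2 = 0"
    using \<phi>_e_e[of 4 2 4] four_le by simp
  moreover have "weight 4 * A 0 2 = weight 3 * A 0 2 + A 0 2"
    by (simp add: weight_def algebra_simps)
  ultimately show ?thesis by (simp add: add_eq_0_iff)
qed

lemma A_0: "2 \<le> i \<Longrightarrow> i \<le> n \<Longrightarrow> A 0 i = 0"
  using A_0_2 A_0_Suc[of "i - 1"] by (cases "i = 2") auto

text \<open>Column 2 is again separate: coordinate 4 for the pair \<open>e 2\<close>,
  \<open>e 3\<close> isolates \<open>A 1 2\<close>.\<close>

lemma A_1:
  assumes "2 \<le> i" "i \<le> n"
  shows "A 1 i = 0"
proof (cases "i = 2")
  case True
  have "A 0 3 = 0" using A_0 four_le by simp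
  then show ?thesis using \<phi>_e_e[of 4 2 3] four_le True by simp
next
  case False
  then have "2 * A 1 i = - A 0 (i - 1)" using A_1_Suc[of "i - 1"] assms by simp
  also have "A 0 (i - 1) = 0" using A_0[of "i - 1"] False assms by linarith
  finally show ?thesis by simp
qed

section \<open>Triangular shape and constant diagonal\<close>

text \<open>The pair \<open>e k\<close>, \<open>e 1\<close> links entry \<open>(m, k)\<close> to
  entry \<open>(m + 1, k + 1)\<close>, so an entry is traced back along its diagonal to row 2, where
  the recursion gives zero outright.\<close>

lemma A_below:
  assumes "m < i" "2 \<le> i" "i \<le> n"
  shows "A m i = 0"
  using assms
proof (induction m arbitrary: i)
  case 0
  then show ?case using A_0 by simp
next
  case (Suc m)
  show ?case
  proof (cases "m = 0")
    case True
    then show ?thesis using A_1 Suc by simp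
  next
    case False
    then obtain k where k: "i = Suc k" "0 < m" "2 \<le> k" "m < k" "k < n"
      using Suc.prems False by (cases i) auto
    then have "2 * A (Suc m) i = (if 3 \<le> Suc m then A m k else 0)"
      using \<phi>_e_e1[of "Suc m" k] A_0_1 by auto
    moreover have "A m k = 0" using Suc.IH k by simp
    ultimately show ?thesis by (auto split: if_splits)
  qed
qed

text \<open>The case \<open>m = i\<close> is excluded because an extra \<open>A 1 1\<close> enters
  on the diagonal.\<close>

lemma A_shift:
  assumes "2 \<le> i" "i < n" "2 \<le> m" "m < n" "m \<noteq> i"
  shows "A (m + 1) (i + 1) = A m i / 2"
  using \<phi>_e_e1[of "m + 1" i] A_0_1 assms by (auto simp: field_simps)

text \<open>A weight may vanish, but \<open>weight 2\<close> and \<open>weight 3\<close> differ by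
  one. Since halving passes the defect \<open>A 2 2 - A 1 1\<close> on to column 3, both weights
  annihilate it.\<close>

lemma A_diag:
  assumes "2 \<le> i" "i \<le> n"
  shows "A i i = A 1 1"
proof -
  have weighted: "weight j * A j j = weight j * A 1 1" if "2 \<le> j" "j \<le> n" for j
    using \<phi>_e_x[of j j] that coord_0_\<phi>_x by (simp add: algebra_simps)
  have halving: "2 * A (j + 1) (j + 1) = A j j + A 1 1" if "2 \<le> j" "j < n" for j
    using \<phi>_e_e1[of "j + 1" j] that by simp
  have A_2_2: "A 2 2 = A 1 1"
  proof -
    have "weight 2 * A 2 2 = weight 2 * A 1 1" "weight 3 * A 3 3 = weight 3 * A 1 1"
      using weighted four_le by auto
    moreover have "2 * A 3 3 = A 2 2 + A 1 1" using halving[of 2] four_le by simp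
    moreover have "weight 3 = weight 2 + 1" by (simp add: weight_def)
    ultimately show ?thesis by algebra
  qed
  show ?thesis using assms
  proof (induction i rule: dec_induct)
    case base
    then show ?case using A_2_2 by simp
  next
    case (step j)
    then have "2 * A (Suc j) (Suc j) = A 1 1 + A 1 1" using halving[of j] by simp
    then show ?case by simp
  qed
qed

section \<open>Entries with row index above the column index\<close>

text \<open>The factor is \<open>weight m - 2 * weight 2\<close>; at \<open>m = n\<close> this is
  the condition on the corner entry.\<close>

lemma A_2_weight: "3 < m \<Longrightarrow> m \<le> n \<Longrightarrow> (of_nat m - 2 - \<beta>) * A m 2 = 0"
  using \<phi>_e_x[of m 2] by (simp add: weight_def algebra_simps)

text \<open>The shifted copy \<open>A (m + 1) 3\<close>, which exists because \<open>m < n\<close>,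
  satisfies a weight condition whose factor differs by one.\<close>

lemma A_above_2:
  assumes "3 < m" "m < n"
  shows "A m 2 = 0"
proof -
  have "A (m + 1) 3 = A m 2 / 2" using A_shift[of 2 m] assms by simp
  moreover have "2 * weight 3 * A (m + 1) 3 = weight (m + 1) * A (m + 1) 3"
    using \<phi>_e_x[of "m + 1" 3] assms by simp
  moreover have "weight 3 = 1 + \<beta>" "weight (m + 1) = of_nat m - 1 + \<beta>"
    using assms by (simp_all add: weight_def)
  ultimately have "(of_nat m - 3 - \<beta>) * A m 2 = 0" by algebra
  moreover have "(of_nat m - 2 - \<beta>) * A m 2 = 0" using A_2_weight assms by simp
  ultimately show ?thesis by algebra
qed

text \<open>The left side is independent of \<open>i\<close>, so this ties together all entries of
  the first subdiagonal.\<close>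

lemma coord_1_\<phi>_x:
  assumes "2 \<le> i" "i < n"
  shows "coord 1 (\<phi> x) = (of_nat i - 3 + \<beta>) * A (i + 1) i"
  using \<phi>_e_x[of "i + 1" i] assms by (simp add: weight_def algebra_simps)

lemma A_4_3: "A 4 3 = A 3 2 / 2"
  using A_shift[of 2 3] four_le by simp

text \<open>Columns 2 and 3 give \<open>(\<beta> - 1) * A 3 2 = \<beta> * A 3 2 / 2\<close>.\<close>

lemma A_3_2_weight: "(\<beta> - 2) * A 3 2 = 0"
  and coord_1_\<phi>_x_eq: "coord 1 (\<phi> x) = A 3 2"
proof -
  have "coord 1 (\<phi> x) = (\<beta> - 1) * A 3 2" "coord 1 (\<phi> x) = \<beta> * (A 3 2 / 2)"
    using coord_1_\<phi>_x[of 2] coord_1_\<phi>_x[of 3] four_le by (simp_all add: A_4_3)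
  then show "(\<beta> - 2) * A 3 2 = 0" "coord 1 (\<phi> x) = A 3 2" by algebra+
qed

text \<open>Column 4 adds \<open>(\<beta> - 3) * A 3 2 = 0\<close>, incompatible with
  \<open>(\<beta> - 2) * A 3 2 = 0\<close> unless the entry vanishes.\<close>

lemma A_3_2:
  assumes "5 \<le> n"
  shows "A 3 2 = 0"
proof -
  have "A 5 4 = A 4 3 / 2" using A_shift[of 3 4] assms by simp
  then have A_5_4: "A 5 4 = A 3 2 / 4" unfolding A_4_3 by simp
  have "A 3 2 = (\<beta> + 1) * (A 3 2 / 4)"
    using coord_1_\<phi>_x[of 4] coord_1_\<phi>_x_eq A_5_4 assms by simp
  then have "(\<beta> - 3) * A 3 2 = 0" by (simp add: field_simps)
  then show ?thesis using A_3_2_weight by auto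
qed

text \<open>Shifting back to column 2 lands in a row strictly less than \<open>n\<close>, so the
  corner \<open>A n 2\<close> never contributes.\<close>

lemma A_above:
  assumes "3 \<le> i" "i < m" "m \<le> n" "5 \<le> n"
  shows "A m i = 0"
  using assms
proof (induction i arbitrary: m rule: dec_induct)
  case base
  have "A m 3 = A (m - 1) 2 / 2" using A_shift[of 2 "m - 1"] base by simp
  moreover have "A (m - 1) 2 = 0"
    using base A_3_2 A_above_2[of "m - 1"] by (cases "m = 4") auto
  ultimately show ?case by simp
next
  case (step i)
  have "A m (Suc i) = A (m - 1) i / 2" using A_shift[of i "m - 1"] step by simp
  moreover have "A (m - 1) i = 0" using step by simp
  ultimately show ?case by simp
qed

end

section \<open>Reading off the images in the two cases\<close>

theorem theorem2p1:
  fixes scl :: "complex \<Rightarrow> 'a::ab_group_add \<Rightarrow> 'a" (infixr \<open>\<odot>\<close> 75)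
    and brk :: "'a \<Rightarrow> 'a \<Rightarrow> 'a"
    and n :: nat and \<beta> :: complex and e :: "nat \<Rightarrow> 'a" and x :: 'a
    and \<phi> :: "'a \<Rightarrow> 'a"
  assumes "n \<ge> 4"
    and "s1_algebra scl brk n \<beta> e x"
    and "half_derivation scl brk \<phi>"
  shows "(n = 4 \<longrightarrow>
      (\<exists>\<alpha>\<^sub>1 \<alpha>\<^sub>2 \<alpha>\<^sub>3 \<alpha>\<^sub>4 \<beta>\<^sub>3 \<beta>\<^sub>4 \<delta>\<^sub>4 :: complex.
        (\<beta> - 2) * \<alpha>\<^sub>2 = 0 \<and> (\<beta> - 2) * \<beta>\<^sub>3 = 0 \<and> (2 - \<beta>) * \<beta>\<^sub>4 = 0 \<and>
        \<phi> (e 1) = \<alpha>\<^sub>1 \<odot> e 1 + \<alpha>\<^sub>2 \<odot> e 2 + \<alpha>\<^sub>3 \<odot> e 3 + \<alpha>\<^sub>4 \<odot> e 4 \<and>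
        \<phi> (e 2) = \<alpha>\<^sub>1 \<odot> e 2 + \<beta>\<^sub>3 \<odot> e 3 + \<beta>\<^sub>4 \<odot> e 4 \<and>
        \<phi> (e 3) = \<alpha>\<^sub>1 \<odot> e 3 + (1/2 * \<beta>\<^sub>3) \<odot> e 4 \<and>
        \<phi> (e 4) = \<alpha>\<^sub>1 \<odot> e 4 \<and>
        \<phi> x = \<beta>\<^sub>3 \<odot> e 1 + ((\<beta> - 1) * \<alpha>\<^sub>3) \<odot> e 2 + (\<beta> * \<alpha>\<^sub>4) \<odot> e 3 + \<delta>\<^sub>4 \<odot> e 4 + \<alpha>\<^sub>1 \<odot> x)) \<and>
    (n \<ge> 5 \<longrightarrow>
      (\<exists>(\<alpha> :: nat \<Rightarrow> complex) (\<beta>\<^sub>n :: complex) (\<delta>\<^sub>n :: complex).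
        (\<beta> - 2) * \<alpha> 2 = 0 \<and> (of_nat n - 2 - \<beta>) * \<beta>\<^sub>n = 0 \<and>
        \<phi> (e 1) = (\<Sum>i=1..n. \<alpha> i \<odot> e i) \<and>
        \<phi> (e 2) = \<alpha> 1 \<odot> e 2 + \<beta>\<^sub>n \<odot> e n \<and>
        (\<forall>i\<in>{3..n}. \<phi> (e i) = \<alpha> 1 \<odot> e i) \<and>
        \<phi> x = (\<Sum>i=2..n - 1. ((of_nat i - 3 + \<beta>) * \<alpha> (i + 1)) \<odot> e i) + \<delta>\<^sub>n \<odot> e n + \<alpha> 1 \<odot> x))"
proof -
  interpret s1_half_derivation scl brk n \<beta> e x \<phi>
    using assms by (simp add: s1_half_derivation_def s1_half_derivation_axioms_def)
  note coord_simps = coord_add coord_scale coord_e coord_x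
  show ?thesis
  proof (intro conjI impI)
    assume n: "n = 4"
    then have cases4: "m = 0 \<or> m = 1 \<or> m = 2 \<or> m = 3 \<or> m = 4" if "m \<le> n" for m
      using that by auto
    note A_simps = A_0_1[simplified] A_below A_diag A_4_3
    have 1: "\<phi> (e 1) = A 1 1 \<odot> e 1 + A 2 1 \<odot> e 2 + A 3 1 \<odot> e 3 + A 4 1 \<odot> e 4"
      by (rule coord_eqI, frule cases4) (use four_le in \<open>auto simp: coord_simps A_simps\<close>)
    have 2: "\<phi> (e 2) = A 1 1 \<odot> e 2 + A 3 2 \<odot> e 3 + A 4 2 \<odot> e 4"
      by (rule coord_eqI, frule cases4) (use four_le in \<open>auto simp: coord_simps A_simps\<close>)
    have 3: "\<phi> (e 3) = A 1 1 \<odot> e 3 + (1/2 * A 3 2) \<odot> e 4"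
      by (rule coord_eqI, frule cases4) (use four_le in \<open>auto simp: coord_simps A_simps\<close>)
    have 4: "\<phi> (e 4) = A 1 1 \<odot> e 4"
      by (rule coord_eqI, frule cases4) (use four_le in \<open>auto simp: coord_simps A_simps\<close>)
    have 5: "\<phi> x = A 3 2 \<odot> e 1 + ((\<beta> - 1) * A 3 1) \<odot> e 2 + (\<beta> * A 4 1) \<odot> e 3 +
        coord 4 (\<phi> x) \<odot> e 4 + A 1 1 \<odot> x"
      by (rule coord_eqI, frule cases4)
        (use coord_\<phi>_x[of 2] coord_\<phi>_x[of 3] coord_1_\<phi>_x_eq coord_0_\<phi>_x four_le
          in \<open>auto simp: coord_simps\<close>)
    \<comment> \<open>For \<open>n = 4\<close> the corner entry is \<open>A 4 2\<close>, and its
      factor \<open>n - 2 - \<beta>\<close> becomes \<open>2 - \<beta>\<close>.\<close>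
    have 6: "(2 - \<beta>) * A 4 2 = 0" using A_2_weight[of 4] n by simp
    show "\<exists>\<alpha>\<^sub>1 \<alpha>\<^sub>2 \<alpha>\<^sub>3 \<alpha>\<^sub>4 \<beta>\<^sub>3 \<beta>\<^sub>4 \<delta>\<^sub>4 :: complex.
        (\<beta> - 2) * \<alpha>\<^sub>2 = 0 \<and> (\<beta> - 2) * \<beta>\<^sub>3 = 0 \<and> (2 - \<beta>) * \<beta>\<^sub>4 = 0 \<and>
        \<phi> (e 1) = \<alpha>\<^sub>1 \<odot> e 1 + \<alpha>\<^sub>2 \<odot> e 2 + \<alpha>\<^sub>3 \<odot> e 3 + \<alpha>\<^sub>4 \<odot> e 4 \<and>
        \<phi> (e 2) = \<alpha>\<^sub>1 \<odot> e 2 + \<beta>\<^sub>3 \<odot> e 3 + \<beta>\<^sub>4 \<odot> e 4 \<and>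
        \<phi> (e 3) = \<alpha>\<^sub>1 \<odot> e 3 + (1/2 * \<beta>\<^sub>3) \<odot> e 4 \<and>
        \<phi> (e 4) = \<alpha>\<^sub>1 \<odot> e 4 \<and>
        \<phi> x = \<beta>\<^sub>3 \<odot> e 1 + ((\<beta> - 1) * \<alpha>\<^sub>3) \<odot> e 2 + (\<beta> * \<alpha>\<^sub>4) \<odot> e 3 + \<delta>\<^sub>4 \<odot> e 4 + \<alpha>\<^sub>1 \<odot> x"
      by (rule exI[of _ "A 1 1"], rule exI[of _ "A 2 1"], rule exI[of _ "A 3 1"],
          rule exI[of _ "A 4 1"], rule exI[of _ "A 3 2"], rule exI[of _ "A 4 2"],
          rule exI[of _ "coord 4 (\<phi> x)"])
        (intro conjI A_2_1 A_3_2_weight 1 2 3 4 5 6)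
  next
    assume n: "n \<ge> 5"
    have 1: "\<phi> (e 1) = (\<Sum>i=1..n. A i 1 \<odot> e i)"
    proof (rule coord_eqI)
      fix m assume m: "m \<le> n"
      have "coord m (\<Sum>i=1..n. A i 1 \<odot> e i) = (\<Sum>i=1..n. if m = i then A i 1 else 0)"
        unfolding coord_sum by (rule sum.cong) (use m in \<open>auto simp: coord_simps\<close>)
      \<comment> \<open>Index 0 lies outside the summation range; there \<open>A_0_1\<close> is
        needed.\<close>
      then show "A m 1 = coord m (\<Sum>i=1..n. A i 1 \<odot> e i)"
        using m A_0_1 by (cases "m = 0") auto
    qed
    have 2: "\<phi> (e 2) = A 1 1 \<odot> e 2 + A n 2 \<odot> e n"
    proof (rule coord_eqI)
      fix m assume "m \<le> n"
      \<comment> \<open>Row 3 lies on the first subdiagonal and is killed by \<open>A_3_2\<close>,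
        the rows between 3 and \<open>n\<close> by weights.\<close>
      then consider "m < 2" | "m = 2" | "m = 3" | "3 < m" "m < n" | "m = n" by linarith
      then show "A m 2 = coord m (A 1 1 \<odot> e 2 + A n 2 \<odot> e n)"
        by cases (use n A_below[of m 2] A_diag[of 2] A_3_2 A_above_2[of m]
            in \<open>auto simp: coord_simps\<close>)
    qed
    have 3: "\<phi> (e i) = A 1 1 \<odot> e i" if "i \<in> {3..n}" for i
    proof (rule coord_eqI)
      fix m assume "m \<le> n"
      moreover consider "m < i" | "m = i" | "i < m" by linarith
      ultimately show "A m i = coord m (A 1 1 \<odot> e i)"
        by cases (use n that A_below[of m i] A_diag[of i] A_above[of i m]
            in \<open>auto simp: coord_simps\<close>)
    qed
    have 4: "\<phi> x = (\<Sum>i=2..n - 1. ((of_nat i - 3 + \<beta>) * A (i + 1) 1) \<odot> e i) +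
        coord n (\<phi> x) \<odot> e n + A 1 1 \<odot> x" (is "_ = ?S + _ + _")
    proof (rule coord_eqI)
      fix m assume m: "m \<le> n"
      have "coord m ?S = (\<Sum>i=2..n - 1. if m = i then coord i (\<phi> x) else 0)"
        unfolding coord_sum by (rule sum.cong) (use m in \<open>auto simp: coord_simps coord_\<phi>_x\<close>)
      then have S: "coord m ?S = (if m \<in> {2..n - 1} then coord m (\<phi> x) else 0)" by simp
      \<comment> \<open>At \<open>m = 1\<close> the right side is zero, matching
        \<open>coord 1 (\<phi> x) = A 3 2 = 0\<close>; at \<open>m = n\<close> the coordinate is its
        own witness.\<close>
      consider "m = 0" | "m = 1" | "m \<in> {2..n - 1}" | "m = n" using m by force
      then show "coord m (\<phi> x) = coord m (?S + coord n (\<phi> x) \<odot> e n + A 1 1 \<odot> x)"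
        unfolding coord_add S
        by cases (use n m coord_0_\<phi>_x coord_1_\<phi>_x_eq A_3_2 in \<open>auto simp: coord_simps\<close>)
    qed
    have 5: "(of_nat n - 2 - \<beta>) * A n 2 = 0" using A_2_weight n by simp
    show "\<exists>(\<alpha> :: nat \<Rightarrow> complex) (\<beta>\<^sub>n :: complex) (\<delta>\<^sub>n :: complex).
        (\<beta> - 2) * \<alpha> 2 = 0 \<and> (of_nat n - 2 - \<beta>) * \<beta>\<^sub>n = 0 \<and>
        \<phi> (e 1) = (\<Sum>i=1..n. \<alpha> i \<odot> e i) \<and>
        \<phi> (e 2) = \<alpha> 1 \<odot> e 2 + \<beta>\<^sub>n \<odot> e n \<and>
        (\<forall>i\<in>{3..n}. \<phi> (e i) = \<alpha> 1 \<odot> e i) \<and>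
        \<phi> x = (\<Sum>i=2..n - 1. ((of_nat i - 3 + \<beta>) * \<alpha> (i + 1)) \<odot> e i) + \<delta>\<^sub>n \<odot> e n + \<alpha> 1 \<odot> x"
      by (rule exI[of _ "\<lambda>i. A i 1"], rule exI[of _ "A n 2"], rule exI[of _ "coord n (\<phi> x)"])
        (intro conjI ballI A_2_1 1 2 3 4 5)
  qed
qed

end
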